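(* Let $(X,\mathbb{F})$ be a non-autonomous system generated by a family $\mathbb{F}=(f_n)$ commuting with a map $f$, and suppose $(f_n)$ converges strongly to $f$. Let $x,y\in X$. If $(x,y)$ is regionally proximal for $(X,f)$, then $(x,y)$ is regionally proximal for $(X,\mathbb{F})$. Further, if $(X,\mathbb{F})$ is asymptotically commutative and $\mathbb{F}$ is a family of homeomorphisms, the converse is also true: if $(x,y)$ is regionally proximal for $(X,\mathbb{F})$, then $(x,y)$ is regionally proximal for $(X,f)$.
   Context: A non-autonomous system $(X,\mathbb{F})$ consists of a compact metric space $(X,d_X)$ and a sequence $\mathbb{F}=(f_n)_{n\ge 1}$ of surjective continuous self-maps of $X$; $\omega_n=f_n\circ\cdots\circ f_1$. $\mathbb{F}$ commutes with $f$ if $f_n\circ f=f\circ f_n$ for all $n$. $(X,f)$ denotes the autonomous system, for which $\omega_n=f^n$. $D_{C(X)}(g,h)=\sup_{x\in X}d_X(g(x),h(x))$ for continuous self-maps $g,h$ of $X$. $(f_n)$ converges strongly to the continuous map $f:X\to X$ if $\sum_{n=1}^\infty D_{C(X)}(f_n,f)<\infty$. A pair $(x,y)\in X\times X$ is regionally proximal for a system if for every $\epsilon>0$ and all neighborhoods $U$ of $x$ and $V$ of $y$ there are $z_1\in U$, $z_2\in V$ such that $\{n\in\mathbb{N}: d_X(\omega_n(z_1),\omega_n(z_2))<\epsilon\}$ is non-empty. $(X,\mathbb{F})$ is asymptotically commutative if $\lim_{n\to\infty}D_{C(X)}(\omega_n\circ\omega_r,\omega_r\circ\omega_n)=0$ for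 every $r\in\mathbb{N}$. *)

theory Defs
  imports "HOL-Analysis.Analysis"
begin

text \<open>
  The compact metric space is a compact set \<open>X\<close> in an ambient metric space, with its subspace
  metric and topology. Maps of \<open>X\<close> are functions on the ambient type of which only the values on
  \<open>X\<close> matter. Families \<open>F\<close> are indexed by \<open>n \<ge> 1\<close>; the entry \<open>F 0\<close> is never used.
\<close>

definition nonautonomous_system :: "'a::metric_space set \<Rightarrow> (nat \<Rightarrow> 'a \<Rightarrow> 'a) \<Rightarrow> bool" where
  "nonautonomous_system X F \<longleftrightarrow>
     compact X \<and> (\<forall>n\<ge>1. continuous_on X (F n) \<and> F n ` X = X)"

primrec omega :: "(nat \<Rightarrow> 'a \<Rightarrow> 'a) \<Rightarrow> nat \<Rightarrow> 'a \<Rightarrow> 'a" where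
  "omega F 0 = id"
| "omega F (Suc n) = F (Suc n) \<circ> omega F n"

text \<open>The autonomous system generated by \<open>f\<close> is the one generated by the constant family.\<close>

lemma omega_const: "omega (\<lambda>_. f) n = f ^^ n"
  by (induction n) auto

definition commutes_with :: "'a set \<Rightarrow> (nat \<Rightarrow> 'a \<Rightarrow> 'a) \<Rightarrow> ('a \<Rightarrow> 'a) \<Rightarrow> bool" where
  "commutes_with X F f \<longleftrightarrow> (\<forall>n\<ge>1. \<forall>x\<in>X. F n (f x) = f (F n x))"

definition D_C :: "'a::metric_space set \<Rightarrow> ('a \<Rightarrow> 'a) \<Rightarrow> ('a \<Rightarrow> 'a) \<Rightarrow> real" where
  "D_C X g h = (SUP x\<in>X. dist (g x) (h x))"

text \<open>The shift by \<open>Suc\<close> makes the series start with the distance from \<open>F 1\<close> to \<open>f\<close>.\<close>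

definition converges_strongly ::
  "'a::metric_space set \<Rightarrow> (nat \<Rightarrow> 'a \<Rightarrow> 'a) \<Rightarrow> ('a \<Rightarrow> 'a) \<Rightarrow> bool" where
  "converges_strongly X F f \<longleftrightarrow>
     continuous_on X f \<and> f ` X \<subseteq> X \<and> summable (\<lambda>n. D_C X (F (Suc n)) f)"

definition regionally_proximal ::
  "'a::metric_space set \<Rightarrow> (nat \<Rightarrow> 'a \<Rightarrow> 'a) \<Rightarrow> 'a \<Rightarrow> 'a \<Rightarrow> bool" where
  "regionally_proximal X F x y \<longleftrightarrow>
     (\<forall>\<epsilon>>0. \<forall>U V. openin (top_of_set X) U \<and> x \<in> U \<and> openin (top_of_set X) V \<and> y \<in> V \<longrightarrow>
        (\<exists>z1\<in>U. \<exists>z2\<in>V. {n. n \<ge> 1 \<and> dist (omega F n z1) (omega F n z2) < \<epsilon>} \<noteq> {}))"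

definition asymptotically_commutative ::
  "'a::metric_space set \<Rightarrow> (nat \<Rightarrow> 'a \<Rightarrow> 'a) \<Rightarrow> bool" where
  "asymptotically_commutative X F \<longleftrightarrow>
     (\<forall>r\<ge>1. (\<lambda>n. D_C X (omega F n \<circ> omega F r) (omega F r \<circ> omega F n)) \<longlonglongrightarrow> 0)"

definition family_of_homeomorphisms ::
  "'a::metric_space set \<Rightarrow> (nat \<Rightarrow> 'a \<Rightarrow> 'a) \<Rightarrow> bool" where
  "family_of_homeomorphisms X F \<longleftrightarrow> (\<forall>n\<ge>1. \<exists>g. homeomorphism X X (F n) g)"

end

theory Submission
  imports Defs
begin

text \<open>
  Since every member of the family commutes with the limit \<open>f\<close>, replacing the factors of
  \<open>omega F (r + k)\<close> after the \<open>r\<close>-th by \<open>f\<close> one at a time costs at most the corresponding terms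
  of the convergent series: \<open>omega F (r + k)\<close> is uniformly close to
  \<open>(f ^^ k) \<circ> omega F r = omega F r \<circ> (f ^^ k)\<close> once \<open>r\<close> is large, for all \<open>k\<close> simultaneously.
  With \<open>r\<close> fixed, uniform continuity of \<open>omega F r\<close> gives the first implication.

  For the converse, let \<open>h\<close> be the inverse of \<open>omega F r\<close>. Then \<open>f ^^ k\<close> is close to
  \<open>omega F (r + k) \<circ> h\<close>, which by asymptotic commutativity is close to \<open>h \<circ> omega F (r + k)\<close>
  for large \<open>k\<close>, and \<open>h\<close> is uniformly continuous. The times of proximality can be taken large
  because, for \<open>x \<noteq> y\<close>, finitely many homeomorphisms cannot bring points near \<open>x\<close> and \<open>y\<close>
  arbitrarily close together.
\<close>

text \<open>A real \<open>SUP\<close> dominates its terms only if they are bounded above;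
  boundedness of \<open>X\<close> ensures this.\<close>

lemma dist_le_D_C:
  assumes "bounded X" "g ` X \<subseteq> X" "h ` X \<subseteq> X" "z \<in> X"
  shows "dist (g z) (h z) \<le> D_C X g h"
proof -
  obtain B where B: "dist a b \<le> B" if "a \<in> X" "b \<in> X" for a b
    using assms(1) unfolding bounded_two_points by blast
  have "bdd_above ((\<lambda>x. dist (g x) (h x)) ` X)"
  proof (rule bdd_aboveI2)
    fix x assume "x \<in> X"
    then show "dist (g x) (h x) \<le> B"
      using assms(2,3) B by blast
  qed
  then show ?thesis
    unfolding D_C_def using assms(4) by (rule cSUP_upper[rotated])
qed

section \<open>The maps \<open>omega F n\<close> and their inverses\<close>

context
  fixes X :: "'a::metric_space set" and F :: "nat \<Rightarrow> 'a \<Rightarrow> 'a"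
  assumes sys: "nonautonomous_system X F"
begin

lemma omega_mem: "z \<in> X \<Longrightarrow> omega F n z \<in> X"
  using sys by (induction n) (auto simp: nonautonomous_system_def)

lemma continuous_on_omega: "continuous_on X (omega F n)"
proof (induction n)
  case (Suc n)
  have "omega F n ` X \<subseteq> X"
    using omega_mem by blast
  then have "continuous_on (omega F n ` X) (F (Suc n))"
    using sys by (auto simp: nonautonomous_system_def intro: continuous_on_subset)
  with Suc show ?case
    by (simp del: comp_apply add: continuous_on_compose)
qed (simp add: continuous_on_id id_def)

lemma uniformly_continuous_on_omega: "uniformly_continuous_on X (omega F n)"
  using compact_uniformly_continuous[OF continuous_on_omega] sys
  by (simp add: nonautonomous_system_def)

lemma omega_homeomorphism:
  assumes "family_of_homeomorphisms X F"
  shows "\<exists>h. homeomorphism X X (omega F n) h"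
proof (induction n)
  case 0
  show ?case
    using homeomorphism_ident by (auto simp: id_def)
next
  case (Suc n)
  obtain h where h: "homeomorphism X X (omega F n) h"
    using Suc by blast
  obtain g where g: "homeomorphism X X (F (Suc n)) g"
    using assms by (auto simp: family_of_homeomorphisms_def)
  show ?case
    using homeomorphism_compose[OF h g] unfolding omega.simps by blast
qed

lemma omega_inverse:
  assumes "family_of_homeomorphisms X F"
  obtains h where "homeomorphism X X (omega F n) h" "uniformly_continuous_on X h"
proof -
  obtain h where h: "homeomorphism X X (omega F n) h"
    using omega_homeomorphism[OF assms] by blast
  then have "uniformly_continuous_on X h"
    using sys by (simp add: nonautonomous_system_def homeomorphism_def compact_uniformly_continuous)
  with h show thesis
    by (rule that)
qed

text \<open>Each \<open>omega F n\<close> has a uniformly continuous inverse, and the minimum of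
  finitely many moduli is positive. In contrapositive form: points at least \<open>c\<close> apart
  stay at least \<delta> apart before time \<open>N\<close>.\<close>

lemma dist_omega_less_imp_dist_less:
  assumes "family_of_homeomorphisms X F" "c > 0"
  shows "\<exists>\<delta>>0. \<forall>n<N. \<forall>a\<in>X. \<forall>b\<in>X. dist (omega F n a) (omega F n b) < \<delta> \<longrightarrow> dist a b < c"
proof (induction N)
  case 0
  show ?case by (auto intro: exI[of _ 1])
next
  case (Suc N)
  obtain \<delta> where \<delta>: "\<delta> > 0"
    "\<forall>n<N. \<forall>a\<in>X. \<forall>b\<in>X. dist (omega F n a) (omega F n b) < \<delta> \<longrightarrow> dist a b < c"
    using Suc by blast
  obtain h where h: "homeomorphism X X (omega F N) h" "uniformly_continuous_on X h"
    using omega_inverse[OF assms(1)] .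
  obtain \<eta> where \<eta>: "\<eta> > 0"
    "\<And>a b. a \<in> X \<Longrightarrow> b \<in> X \<Longrightarrow> dist b a < \<eta> \<Longrightarrow> dist (h b) (h a) < c"
    using h(2) \<open>c > 0\<close> unfolding uniformly_continuous_on_def by meson
  have "dist a b < c" if "a \<in> X" "b \<in> X" "dist (omega F N a) (omega F N b) < \<eta>" for a b
    using \<eta>(2)[of "omega F N b" "omega F N a"] that omega_mem homeomorphism_apply1[OF h(1)] by simp
  with \<delta> \<eta>(1) show ?case
    by (intro exI[of _ "min \<delta> \<eta>"]) (auto simp: less_Suc_eq)
qed

lemma regionally_proximal_large_times:
  assumes homeo: "family_of_homeomorphisms X F"
    and rp: "regionally_proximal X F x y" and "x \<in> X" "y \<in> X" "x \<noteq> y"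
    and "\<epsilon> > 0" "openin (top_of_set X) U" "x \<in> U" "openin (top_of_set X) V" "y \<in> V"
  shows "\<exists>z1\<in>U. \<exists>z2\<in>V. \<exists>n\<ge>N. dist (omega F n z1) (omega F n z2) < \<epsilon>"
proof -
  \<comment> \<open>With a third of the distance, points of the \<open>c\<close>-balls around
    \<open>x\<close> and \<open>y\<close> are more than \<open>c\<close> apart, so closeness below
    \<delta> cannot occur before time \<open>N\<close>.\<close>
  define c where "c = dist x y / 3"
  have "c > 0" using \<open>x \<noteq> y\<close> by (simp add: c_def)
  obtain \<delta> where \<delta>: "\<delta> > 0"
    "\<And>n a b. n < N \<Longrightarrow> a \<in> X \<Longrightarrow> b \<in> X \<Longrightarrow> dist (omega F n a) (omega F n b) < \<delta> \<Longrightarrow> dist a b < c"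
    using dist_omega_less_imp_dist_less[OF homeo \<open>c > 0\<close>, of N] by blast
  have "openin (top_of_set X) (U \<inter> ball x c)" "openin (top_of_set X) (V \<inter> ball y c)"
    using assms by (auto simp: openin_Int_open)
  moreover have "x \<in> U \<inter> ball x c" "y \<in> V \<inter> ball y c" "min \<epsilon> \<delta> > 0"
    using assms \<delta>(1) \<open>c > 0\<close> by auto
  ultimately obtain z1 z2 n where z: "z1 \<in> U \<inter> ball x c" "z2 \<in> V \<inter> ball y c"
    "dist (omega F n z1) (omega F n z2) < min \<epsilon> \<delta>"
    using rp unfolding regionally_proximal_def by blast
  have zX: "z1 \<in> X" "z2 \<in> X"
    using z assms openin_imp_subset by blast+
  have "\<not> n < N"
  proof
    assume "n < N"
    then have "dist z1 z2 < c"
      using \<delta>(2) z(3) zX by simp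
    moreover have "dist x z1 < c" "dist y z2 < c"
      using z by auto
    moreover have "dist x y \<le> dist x z1 + dist z1 z2 + dist y z2"
      by metric
    ultimately show False
      by (simp add: c_def)
  qed
  with z show ?thesis
    by (auto simp: not_less)
qed

section \<open>Comparison with the iterates of the limit map\<close>

context
  fixes f :: "'a \<Rightarrow> 'a"
  assumes comm: "commutes_with X F f" and conv: "converges_strongly X F f"
begin

lemma funpow_mem: "z \<in> X \<Longrightarrow> (f ^^ k) z \<in> X"
  using conv by (induction k) (auto simp: converges_strongly_def)

lemma omega_commute: "z \<in> X \<Longrightarrow> omega F n (f z) = f (omega F n z)"
  using comm omega_mem by (induction n) (auto simp: commutes_with_def)

lemma omega_funpow_commute: "z \<in> X \<Longrightarrow> omega F n ((f ^^ k) z) = (f ^^ k) (omega F n z)"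
  by (induction k) (auto simp: omega_commute funpow_mem)

lemma dist_omega_funpow_le_sum:
  assumes "z \<in> X"
  shows "dist (omega F (r + k) z) ((f ^^ k) (omega F r z))
           \<le> (\<Sum>i=r..<r + k. D_C X (F (Suc i)) f)"
  using assms
proof (induction k arbitrary: z)
  case (Suc k)
  let ?w = "omega F (r + k) z"
  have fX: "f ` X \<subseteq> X"
    using conv by (simp add: converges_strongly_def)
  have "dist (F (Suc (r + k)) ?w) (f ?w) \<le> D_C X (F (Suc (r + k))) f"
    using sys fX omega_mem[OF Suc.prems]
    by (intro dist_le_D_C) (auto simp: nonautonomous_system_def compact_imp_bounded)
  \<comment> \<open>The outermost factor is now \<open>f\<close>. It commutes past
    \<open>omega F (r + k)\<close> to act on \<open>z\<close> first, hence the induction hypothesis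
    at \<open>f z\<close>.\<close>
  moreover have "dist (f ?w) ((f ^^ Suc k) (omega F r z))
      \<le> (\<Sum>i=r..<r + k. D_C X (F (Suc i)) f)"
    using Suc.IH[of "f z"] Suc.prems fX
    by (simp add: omega_commute image_subset_iff funpow_swap1)
  ultimately have "dist (F (Suc (r + k)) ?w) ((f ^^ Suc k) (omega F r z))
      \<le> D_C X (F (Suc (r + k))) f + (\<Sum>i=r..<r + k. D_C X (F (Suc i)) f)"
    by (rule order_trans[OF dist_triangle add_mono])
  then show ?case
    by (simp add: add.commute)
qed simp

text \<open>The Cauchy criterion bounds all blocks of the series starting at \<open>r\<close>,
  whatever their length, so \<open>r\<close> depends neither on \<open>k\<close> nor on
  \<open>z\<close>.\<close>

lemma omega_close_to_funpow:
  assumes "\<epsilon> > 0"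
  obtains r where "\<And>k z. z \<in> X \<Longrightarrow> dist (omega F (r + k) z) ((f ^^ k) (omega F r z)) < \<epsilon>"
proof -
  have "summable (\<lambda>i. D_C X (F (Suc i)) f)"
    using conv by (simp add: converges_strongly_def)
  then obtain r where r: "\<forall>m\<ge>r. \<forall>n. norm (\<Sum>i=m..<n. D_C X (F (Suc i)) f) < \<epsilon>"
    using assms by (auto simp only: summable_Cauchy)
  have "dist (omega F (r + k) z) ((f ^^ k) (omega F r z)) < \<epsilon>" if "z \<in> X" for k z
  proof -
    have "norm (\<Sum>i=r..<r + k. D_C X (F (Suc i)) f) < \<epsilon>"
      using r by simp
    then show ?thesis
      using dist_omega_funpow_le_sum[OF that, of r k] by simp
  qed
  then show ?thesis
    by (rule that)
qed

lemma regionally_proximal_if_limit: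
  assumes "regionally_proximal X (\<lambda>_. f) x y"
  shows "regionally_proximal X F x y"
  unfolding regionally_proximal_def
proof (intro allI impI, elim conjE)
  fix \<epsilon> :: real and U V
  assume "\<epsilon> > 0" and U: "openin (top_of_set X) U" "x \<in> U"
    and V: "openin (top_of_set X) V" "y \<in> V"
  then have e3: "\<epsilon> / 3 > 0" by simp
  obtain r where r: "\<And>k z. z \<in> X \<Longrightarrow> dist (omega F (r + k) z) ((f ^^ k) (omega F r z)) < \<epsilon> / 3"
    by (rule omega_close_to_funpow[OF e3]) blast
  obtain \<delta> where \<delta>: "\<delta> > 0"
    "\<And>a b. a \<in> X \<Longrightarrow> b \<in> X \<Longrightarrow> dist b a < \<delta> \<Longrightarrow> dist (omega F r b) (omega F r a) < \<epsilon> / 3"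
    using uniformly_continuous_on_omega[of r] e3 unfolding uniformly_continuous_on_def by meson
  obtain z1 z2 k where z: "z1 \<in> U" "z2 \<in> V" "k \<ge> 1" "dist ((f ^^ k) z1) ((f ^^ k) z2) < \<delta>"
    using assms U V \<delta>(1) unfolding regionally_proximal_def omega_const by blast
  have zX: "z1 \<in> X" "z2 \<in> X"
    using z U V openin_imp_subset by blast+
  \<comment> \<open>Uniform continuity of \<open>omega F r\<close> applies to the iterates of
    \<open>z1\<close> and \<open>z2\<close>; commutation then moves \<open>omega F r\<close>
    inside.\<close>
  have "dist ((f ^^ k) (omega F r z1)) ((f ^^ k) (omega F r z2)) < \<epsilon> / 3"
    using \<delta>(2)[OF funpow_mem funpow_mem z(4)] zX by (simp add: omega_funpow_commute)
  with r[OF zX(1), of k] r[OF zX(2), of k]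
  have "dist (omega F (r + k) z1) (omega F (r + k) z2) < \<epsilon>"
    by metric
  moreover have "r + k \<ge> 1"
    using z(3) by simp
  ultimately show "\<exists>z1\<in>U. \<exists>z2\<in>V. {n. n \<ge> 1 \<and> dist (omega F n z1) (omega F n z2) < \<epsilon>} \<noteq> {}"
    using z(1,2) by blast
qed

lemma limit_regionally_proximal_if:
  assumes ac: "asymptotically_commutative X F" and homeo: "family_of_homeomorphisms X F"
    and rp: "regionally_proximal X F x y" and xy: "x \<in> X" "y \<in> X"
  shows "regionally_proximal X (\<lambda>_. f) x y"
proof (cases "x = y")
  case True
  then show ?thesis
    by (auto simp: regionally_proximal_def intro!: bexI[of _ y] exI[of _ 1])
next
  case False
  show ?thesis
    unfolding regionally_proximal_def
  proof (intro allI impI, elim conjE)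
    fix \<epsilon> :: real and U V
    assume "\<epsilon> > 0" and U: "openin (top_of_set X) U" "x \<in> U"
      and V: "openin (top_of_set X) V" "y \<in> V"
    \<comment> \<open>Five links: from \<open>(f ^^ k) z1\<close> through
      \<open>omega F n (h z1)\<close>, \<open>h (omega F n z1)\<close>,
      \<open>h (omega F n z2)\<close> and \<open>omega F n (h z2)\<close> to
      \<open>(f ^^ k) z2\<close>.\<close>
    then have e5: "\<epsilon> / 5 > 0" by simp
    obtain r where r: "\<And>k z. z \<in> X \<Longrightarrow> dist (omega F (r + k) z) ((f ^^ k) (omega F r z)) < \<epsilon> / 5"
      by (rule omega_close_to_funpow[OF e5]) blast
    obtain h where h: "homeomorphism X X (omega F r) h" and hu: "uniformly_continuous_on X h"
      using omega_inverse[OF homeo] .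
    have hX: "h z \<in> X" if "z \<in> X" for z
      using h that by (auto simp: homeomorphism_def)
    obtain \<delta> where \<delta>: "\<delta> > 0"
      "\<And>a b. a \<in> X \<Longrightarrow> b \<in> X \<Longrightarrow> dist b a < \<delta> \<Longrightarrow> dist (h b) (h a) < \<epsilon> / 5"
      using hu e5 unfolding uniformly_continuous_on_def by meson
    have "\<exists>N. \<forall>n\<ge>N. D_C X (omega F n \<circ> omega F r) (omega F r \<circ> omega F n) < \<delta>"
    proof (cases "r = 0")
      \<comment> \<open>Asymptotic commutativity speaks only of indices from 1 on; for index 0 both
        composites agree and the supremum over the nonempty \<open>X\<close> is 0.\<close>
      case True
      have "X \<noteq> {}" using xy by blast
      then show ?thesis
        using \<delta>(1) by (simp add: True D_C_def)
    next
      case False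
      then have "(\<lambda>n. D_C X (omega F n \<circ> omega F r) (omega F r \<circ> omega F n)) \<longlonglongrightarrow> 0"
        using ac by (simp add: asymptotically_commutative_def)
      from order_tendstoD(2)[OF this \<delta>(1)] show ?thesis
        by (simp only: eventually_sequentially)
    qed
    then obtain N where N:
      "\<And>n. n \<ge> N \<Longrightarrow> D_C X (omega F n \<circ> omega F r) (omega F r \<circ> omega F n) < \<delta>"
      by blast
    have commute: "dist (h (omega F n z)) (omega F n (h z)) < \<epsilon> / 5" if "n \<ge> N" "z \<in> X" for n z
    proof -
      \<comment> \<open>Evaluating at \<open>h z\<close> cancels \<open>omega F r\<close> in the
        first composite; applying \<open>h\<close> afterwards cancels it in the second.\<close>
      have "dist ((omega F n \<circ> omega F r) (h z)) ((omega F r \<circ> omega F n) (h z)) < \<delta>"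
        using sys omega_mem hX that
        by (intro order_le_less_trans[OF dist_le_D_C N])
          (auto simp: nonautonomous_system_def compact_imp_bounded)
      then have "dist (omega F n z) (omega F r (omega F n (h z))) < \<delta>"
        using homeomorphism_apply2[OF h] that by simp
      then have "dist (h (omega F n z)) (h (omega F r (omega F n (h z)))) < \<epsilon> / 5"
        using that by (intro \<delta>(2) omega_mem hX)
      then show ?thesis
        using homeomorphism_apply1[OF h] omega_mem hX that by simp
    qed
    \<comment> \<open>The bound \<open>N\<close> gives near-commutation with \<open>h\<close>, and
      \<open>Suc r\<close> makes the remaining time \<open>k = n - r\<close> positive.\<close>
    obtain z1 z2 n where z: "z1 \<in> U" "z2 \<in> V" "n \<ge> max N (Suc r)"
      "dist (omega F n z1) (omega F n z2) < \<delta>"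
      using regionally_proximal_large_times[OF homeo rp xy False \<delta>(1) U V] by blast
    have zX: "z1 \<in> X" "z2 \<in> X"
      using z U V openin_imp_subset by blast+
    obtain k where k: "n = r + k" "k \<ge> 1"
      using z(3) by (intro that[of "n - r"]) auto
    have approx: "dist (omega F n (h a)) ((f ^^ k) a) < \<epsilon> / 5" if "a \<in> X" for a
      using r[OF hX[OF that], of k] homeomorphism_apply2[OF h that] k by simp
    have "dist (h (omega F n z1)) (h (omega F n z2)) < \<epsilon> / 5"
      using \<delta>(2) z(4) omega_mem zX by blast
    moreover have "dist (h (omega F n z1)) (omega F n (h z1)) < \<epsilon> / 5"
      "dist (h (omega F n z2)) (omega F n (h z2)) < \<epsilon> / 5"
      using commute z(3) zX by auto
    ultimately have "dist ((f ^^ k) z1) ((f ^^ k) z2) < \<epsilon>"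
      using approx[OF zX(1)] approx[OF zX(2)]
        dist_triangle[of "(f ^^ k) z1" "(f ^^ k) z2" "omega F n (h z1)"]
        dist_triangle[of "omega F n (h z1)" "(f ^^ k) z2" "h (omega F n z1)"]
        dist_triangle[of "h (omega F n z1)" "(f ^^ k) z2" "h (omega F n z2)"]
        dist_triangle[of "h (omega F n z2)" "(f ^^ k) z2" "omega F n (h z2)"]
      by (simp add: dist_commute)
    then show "\<exists>z1\<in>U. \<exists>z2\<in>V.
        {n. n \<ge> 1 \<and> dist (omega (\<lambda>_. f) n z1) (omega (\<lambda>_. f) n z2) < \<epsilon>} \<noteq> {}"
      using z k unfolding omega_const by blast
  qed
qed

end

end

theorem corollary5p1:
  fixes X :: "'a::metric_space set"
    and F :: "nat \<Rightarrow> 'a \<Rightarrow> 'a"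
    and f :: "'a \<Rightarrow> 'a"
    and x y :: 'a
  assumes "nonautonomous_system X F"
    and "commutes_with X F f"
    and "converges_strongly X F f"
    and "x \<in> X" and "y \<in> X"
  shows "(regionally_proximal X (\<lambda>_. f) x y \<longrightarrow> regionally_proximal X F x y) \<and>
         (asymptotically_commutative X F \<and> family_of_homeomorphisms X F \<longrightarrow>
            regionally_proximal X F x y \<longrightarrow> regionally_proximal X (\<lambda>_. f) x y)"
  using regionally_proximal_if_limit[OF assms(1-3)] limit_regionally_proximal_if[OF assms(1-3)]
    assms(4,5)
  by blast

end
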